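(* Let $q\ge 5$ be an odd integer and let $n=(q^2-5)/4$. For every nonzero integer $r$, the multiset $$\{r^{[n^2-1]},(n+2)r\}$$ is $\mathrm{PSI}$ in dimension $n$.
   Context: For a multiset $\mathcal{S}$ of $n^2$ integers, $\mathcal{M}_n(\mathcal{S})$ denotes the set of all $n\times n$ integer matrices whose $n^2$ entries, counted with multiplicity, are exactly the elements of $\mathcal{S}$. A matrix has integral spectrum if all its eigenvalues are integers. $\mathcal{S}$ is permutation-spectrally integral in dimension $n$ ($\mathrm{PSI}$ in dimension $n$, or $\mathrm{PSI}_n$) if every matrix in $\mathcal{M}_n(\mathcal{S})$ has integral spectrum. The notation $x^{[m]}$ means $m$ copies of $x$. *)

theory Defs
  imports Complex_Main "HOL-Library.Multiset" "Jordan_Normal_Form.Spectral_Radius"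
begin

definition entries_mset :: "'a mat \<Rightarrow> 'a multiset" where
  "entries_mset A =
     image_mset (\<lambda>ij. A $$ ij) (mset_set ({..<dim_row A} \<times> {..<dim_col A}))"

definition matrices_with_entries :: "nat \<Rightarrow> int multiset \<Rightarrow> int mat set" where
  "matrices_with_entries n S = {A \<in> carrier_mat n n. entries_mset A = S}"

(* Eigenvalues are taken over the complex numbers, so that non-real and irrational ones count. *)
definition integral_spectrum :: "int mat \<Rightarrow> bool" where
  "integral_spectrum A \<longleftrightarrow> spectrum (map_mat complex_of_int A) \<subseteq> \<int>"

(* The size condition is part of the notion: without it, a multiset of the wrong size would
   satisfy the universally quantified clause vacuously. *)
definition PSI :: "nat \<Rightarrow> int multiset \<Rightarrow> bool" where
  "PSI n S \<longleftrightarrow> size S = n\<^sup>2 \<and> (\<forall>A \<in> matrices_with_entries n S. integral_spectrum A)"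

end

theory Submission imports Defs begin

text \<open>
  A matrix with the prescribed entries is constantly \<open>r\<close>, except for one entry
  \<open>(1 + c) r\<close> with \<open>c = n + 1\<close>. Write \<open>(i, j)\<close> for the position of that entry. The
  matrix is \<open>r (J + c E)\<close>, where \<open>J\<close> is the all-ones matrix and \<open>E\<close> the matrix unit at
  \<open>(i, j)\<close>; it has rank at most two, so its nonzero eigenvalues are roots of a quadratic that
  depends only on whether \<open>(i, j)\<close> lies on the diagonal. These quadratics are found in
  \<open>eigenvalue_const_mat_plus_unit\<close>. In units of \<open>r\<close> they are as follows.

  Off the diagonal, \<open>x\<^sup>2 - n x - c = (x - (n + 1)) (x + 1)\<close>, which splits because
  \<open>c = n + 1\<close>.

  On the diagonal, \<open>x\<^sup>2 - (n + c) x + c (n - 1) = x\<^sup>2 - (2 n + 1) x + (n\<^sup>2 - 1)\<close>, whose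
  discriminant is \<open>4 n + 5 = q\<^sup>2\<close>. The roots \<open>(2 n + 1 \<plusminus> q) / 2\<close> are integers since
  \<open>q\<close> is odd. The form of \<open>n\<close> is thus what makes the diagonal case split as well.
\<close>

lemma image_mset_eq_replicate_plus_single:
  assumes "finite X" and eq: "image_mset f (mset_set X) = replicate_mset m a + {#b#}"
  obtains x where "x \<in> X" "f x = b" "\<And>y. y \<in> X \<Longrightarrow> y \<noteq> x \<Longrightarrow> f y = a"
proof -
  have "b \<in># image_mset f (mset_set X)" by (simp add: eq)
  then obtain x where x: "x \<in> X" "f x = b" using \<open>finite X\<close> by auto
  have "mset_set X = add_mset x (mset_set (X - {x}))"
    using x \<open>finite X\<close> by (simp add: mset_set.remove)
  hence rest: "image_mset f (mset_set (X - {x})) = replicate_mset m a"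
    using eq x by simp
  have "f y = a" if "y \<in> X" "y \<noteq> x" for y
  proof -
    have "f y \<in># image_mset f (mset_set (X - {x}))" using that \<open>finite X\<close> by auto
    thus ?thesis unfolding rest by (simp split: if_splits)
  qed
  with x that show thesis by blast
qed

text \<open>
  Let \<open>v\<close> be an eigenvector with coordinate sum \<open>s\<close>. The eigenvalue equation expresses every
  coordinate of \<open>\<mu> v\<close> through the two numbers \<open>s\<close> and \<open>v\<^sub>j\<close> alone. Summing all
  coordinates, and reading off coordinate \<open>j\<close>, gives two linear equations between these two
  numbers. Not both \<open>r s\<close> and \<open>v\<^sub>j\<close> vanish, since otherwise \<open>\<mu> v = 0\<close>; hence the
  determinant of the two equations is zero, and up to sign this is the quadratic for \<open>\<mu>\<close>.
  The coordinate \<open>j\<close> carries the extra term only when \<open>i = j\<close>, so there are two cases.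
\<close>

lemma eigenvalue_const_mat_plus_unit:
  fixes A :: "'a :: field mat"
  assumes A: "A \<in> carrier_mat n n" and ij: "i < n" "j < n"
    and entries: "\<And>k l. k < n \<Longrightarrow> l < n \<Longrightarrow>
      A $$ (k, l) = r + (if (k, l) = (i, j) then c * r else 0)"
    and ev: "eigenvalue A \<mu>" and nz: "\<mu> \<noteq> 0"
  shows "i \<noteq> j \<Longrightarrow> \<mu>\<^sup>2 - of_nat n * r * \<mu> - c * r\<^sup>2 = 0"
    and "i = j \<Longrightarrow> \<mu>\<^sup>2 - (of_nat n + c) * r * \<mu> + c * (of_nat n - 1) * r\<^sup>2 = 0"
proof -
  obtain v where v: "v \<in> carrier_vec n" "v \<noteq> 0\<^sub>v n" "A *\<^sub>v v = \<mu> \<cdot>\<^sub>v v"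
    using ev A unfolding eigenvalue_def eigenvector_def by auto
  define s where "s = (\<Sum>l<n. v $ l)"
  have row: "\<mu> * v $ k = r * s + (if k = i then c * r * v $ j else 0)" if k: "k < n" for k
  proof -
    have "\<mu> * v $ k = (A *\<^sub>v v) $ k" using v k by simp
    also have "\<dots> = (\<Sum>l<n. A $$ (k, l) * v $ l)"
      using A v(1) k by (simp add: scalar_prod_def atLeast0LessThan)
    also have "\<dots> = (\<Sum>l<n. r * v $ l + (if l = j then if k = i then c * r * v $ j else 0 else 0))"
      by (rule sum.cong) (use k in \<open>auto simp: entries algebra_simps\<close>)
    also have "\<dots> = r * s + (if k = i then c * r * v $ j else 0)"
      using ij by (simp add: sum.distrib sum_distrib_left s_def)
    finally show ?thesis .
  qed
  have total: "\<mu> * s = of_nat n * r * s + c * r * v $ j"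
  proof -
    have "\<mu> * s = (\<Sum>k<n. \<mu> * v $ k)" by (simp add: s_def sum_distrib_left)
    also have "\<dots> = (\<Sum>k<n. r * s + (if k = i then c * r * v $ j else 0))"
      by (rule sum.cong) (simp_all add: row)
    also have "\<dots> = of_nat n * r * s + c * r * v $ j"
      using ij by (simp add: sum.distrib mult.assoc)
    finally show ?thesis .
  qed
  have nonzero: "r * s \<noteq> 0 \<or> v $ j \<noteq> 0"
  proof (rule ccontr)
    assume zero: "\<not> ?thesis"
    have "v $ k = 0" if "k < n" for k
      using row[OF that] zero nz by (auto split: if_splits)
    hence "v = 0\<^sub>v n" using v by (intro eq_vecI) auto
    thus False using v by blast
  qed
  show "\<mu>\<^sup>2 - of_nat n * r * \<mu> - c * r\<^sup>2 = 0" if "i \<noteq> j"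
  proof -
    have vj: "\<mu> * v $ j = r * s" using row[OF ij(2)] that by simp
    have "s \<noteq> 0" using nonzero vj nz by auto
    \<comment> \<open>Cramer's rule: the multipliers of the two equations are the cofactors that
      eliminate \<open>v\<^sub>j\<close>.\<close>
    have "(\<mu>\<^sup>2 - of_nat n * r * \<mu> - c * r\<^sup>2) * s =
        \<mu> * (\<mu> * s - (of_nat n * r * s + c * r * v $ j)) + c * r * (\<mu> * v $ j - r * s)"
      by (simp add: power2_eq_square algebra_simps)
    hence "(\<mu>\<^sup>2 - of_nat n * r * \<mu> - c * r\<^sup>2) * s = 0"
      using total vj by simp
    with \<open>s \<noteq> 0\<close> show ?thesis by simp
  qed
  show "\<mu>\<^sup>2 - (of_nat n + c) * r * \<mu> + c * (of_nat n - 1) * r\<^sup>2 = 0" if "i = j"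
  proof -
    have vj: "\<mu> * v $ j = r * s + c * r * v $ j" using row[OF ij(2)] that by simp
    have "v $ j \<noteq> 0" using nonzero vj by auto
    \<comment> \<open>Cramer's rule: the multipliers of the two equations are the cofactors that
      eliminate \<open>s\<close>.\<close>
    have "(\<mu>\<^sup>2 - (of_nat n + c) * r * \<mu> + c * (of_nat n - 1) * r\<^sup>2) * v $ j =
        (\<mu> - of_nat n * r) * (\<mu> * v $ j - (r * s + c * r * v $ j))
          + r * (\<mu> * s - (of_nat n * r * s + c * r * v $ j))"
      by (simp add: power2_eq_square algebra_simps)
    hence "(\<mu>\<^sup>2 - (of_nat n + c) * r * \<mu> + c * (of_nat n - 1) * r\<^sup>2) * v $ j = 0"
      using total vj by simp
    with \<open>v $ j \<noteq> 0\<close> show ?thesis by simp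
  qed
qed

theorem corollary5p3:
  fixes q r :: int and n :: nat
  assumes "q \<ge> 5" and "odd q"
    and "int n = (q\<^sup>2 - 5) div 4"
    and "r \<noteq> 0"
  shows "PSI n (replicate_mset (n\<^sup>2 - 1) r + {#(int n + 2) * r#})"
proof -
  \<comment> \<open>In terms of \<open>m = (q - 1) / 2\<close>, the diagonal quadratic has the roots
    \<open>n + 1 + m\<close> and \<open>n - m\<close> in units of \<open>r\<close>.\<close>
  obtain m where m: "q = 2 * m + 1" using \<open>odd q\<close> by (elim oddE)
  have "q\<^sup>2 - 5 = 4 * (m\<^sup>2 + m - 1)" by (simp add: m power2_eq_square algebra_simps)
  hence nm: "int n = m\<^sup>2 + m - 1" using assms(3) by simp
  have "m \<ge> 2" using \<open>q \<ge> 5\<close> m by simp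
  hence "int n > 0" using nm zero_le_power2[of m] by linarith
  hence "n\<^sup>2 > 0" by simp
  hence size: "n\<^sup>2 - 1 + 1 = n\<^sup>2" by simp
  have "integral_spectrum A"
    if A: "A \<in> carrier_mat n n"
      and ms: "entries_mset A = replicate_mset (n\<^sup>2 - 1) r + {#(int n + 2) * r#}" for A
  proof -
    have dims: "dim_row A = n" "dim_col A = n" using A by auto
    obtain p where p: "p \<in> {..<n} \<times> {..<n}" "A $$ p = (int n + 2) * r"
      and others: "\<And>x. x \<in> {..<n} \<times> {..<n} \<Longrightarrow> x \<noteq> p \<Longrightarrow> A $$ x = r"
      using ms unfolding entries_mset_def dims
      by (elim image_mset_eq_replicate_plus_single[rotated]) auto
    obtain i j where ij: "p = (i, j)" "i < n" "j < n" using p(1) by auto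
    define B where "B = map_mat complex_of_int A"
    have B: "B \<in> carrier_mat n n" using A by (simp add: B_def)
    have entries: "B $$ (k, l) =
        of_int r + (if (k, l) = (i, j) then (of_nat n + 1) * of_int r else 0)"
      if "k < n" "l < n" for k l
      using that dims p(2) others[of "(k, l)"] by (auto simp: B_def ij algebra_simps)
    have "\<mu> \<in> \<int>" if ev: "eigenvalue B \<mu>" for \<mu>
    proof (cases "\<mu> = 0")
      case False
      have quadratic:
        "i \<noteq> j \<Longrightarrow> \<mu>\<^sup>2 - of_nat n * of_int r * \<mu> - (of_nat n + 1) * (of_int r)\<^sup>2 = 0"
        "i = j \<Longrightarrow> \<mu>\<^sup>2 - (of_nat n + (of_nat n + 1)) * of_int r * \<mu>
            + (of_nat n + 1) * (of_nat n - 1) * (of_int r)\<^sup>2 = 0"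
        using eigenvalue_const_mat_plus_unit[OF B ij(2,3) entries ev False] by blast+
      show ?thesis
      proof (cases "i = j")
        case True
        have nm': "complex_of_nat n = (of_int m)\<^sup>2 + of_int m - 1"
          using arg_cong[OF nm, of complex_of_int] by simp
        have "(\<mu> - of_int ((int n + 1 + m) * r)) * (\<mu> - of_int ((int n - m) * r)) =
            \<mu>\<^sup>2 - (of_nat n + (of_nat n + 1)) * of_int r * \<mu>
              + (of_nat n + 1) * (of_nat n - 1) * (of_int r)\<^sup>2"
          by (simp add: nm' power2_eq_square algebra_simps)
        also have "\<dots> = 0" by (rule quadratic(2)[OF True])
        finally have "(\<mu> - of_int ((int n + 1 + m) * r)) * (\<mu> - of_int ((int n - m) * r)) = 0" .
        hence "\<mu> = of_int ((int n + 1 + m) * r) \<or> \<mu> = of_int ((int n - m) * r)" by simp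
        thus ?thesis by (metis Ints_of_int)
      next
        case False
        have "(\<mu> - of_int ((int n + 1) * r)) * (\<mu> - of_int (- r)) =
            \<mu>\<^sup>2 - of_nat n * of_int r * \<mu> - (of_nat n + 1) * (of_int r)\<^sup>2"
          by (simp add: power2_eq_square algebra_simps)
        also have "\<dots> = 0" by (rule quadratic(1)[OF False])
        finally have "(\<mu> - of_int ((int n + 1) * r)) * (\<mu> - of_int (- r)) = 0" .
        hence "\<mu> = of_int ((int n + 1) * r) \<or> \<mu> = of_int (- r)"
          by (simp only: mult_eq_0_iff right_minus_eq)
        thus ?thesis by (metis Ints_of_int)
      qed
    qed simp
    thus ?thesis unfolding integral_spectrum_def spectrum_def B_def by auto
  qed
  thus ?thesis using size by (simp add: PSI_def matrices_with_entries_def)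
qed

end
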